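(* Let $\Sigma=\{\alpha_1,\alpha_2,\dots\}$ be an infinite countable alphabet, $\upsilon\notin\Sigma$ a variable, $\vec k=(k_n)_{n\in\mathbb N}\subseteq\mathbb N$ an increasing sequence and $r,s\in\mathbb N$. If $W(\Sigma,\vec k;\upsilon)=A_1\cup\dots\cup A_r$ and $W(\Sigma,\vec k)=C_1\cup\dots\cup C_s$, then there exist a sequence $(u_n)_{n\in\mathbb N}\in W^\infty(\Sigma,\vec k;\upsilon)$ and $1\le i_0\le r$, $1\le j_0\le s$ such that $T_{p_1}(u_{n_1})\star\cdots\star T_{p_\lambda}(u_{n_\lambda})\in A_{i_0}$ for every $\lambda\in\mathbb N$, $n_1<\dots<n_\lambda$ in $\mathbb N$ and $p_1,\dots,p_\lambda\in\mathbb N\cup\{0\}$ with $0\le p_i\le k_{n_i}$ for all $i$ and $0\in\{p_1,\dots,p_\lambda\}$; and $T_{p_1}(u_{n_1})\star\cdots\star T_{p_\lambda}(u_{n_\lambda})\in C_{j_0}$ for every $\lambda\in\mathbb N$, $n_1<\dots<n_\lambda$ in $\mathbb N$ and $p_1,\dots,p_\lambda\in\mathbb N$ with $1\le p_i\le k_{n_i}$ for all $i$.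
   Context: $\mathbb N=\{1,2,\dots\}$. $W(\Sigma,\vec k)$ is the set of words $w=w_1\dots w_l$ ($l\in\mathbb N$) with $w_i\in\{\alpha_1,\dots,\alpha_{k_i}\}$ for each $i$; $W(\Sigma,\vec k;\upsilon)$ is the set of words $w=w_1\dots w_l$ with $w_i\in\{\upsilon,\alpha_1,\dots,\alpha_{k_i}\}$ for each $i$ and $w_i=\upsilon$ for at least one $i$. For $w=w_1\dots w_l$, $u=u_1\dots u_r$ in $W(\Sigma,\vec k)\cup W(\Sigma,\vec k;\upsilon)$, write $w<u$ iff $l<r$ and $u_1=\dots=u_l=\alpha_1$; in that case $w\star u=w_1\dots w_lu_{l+1}\dots u_r$ (iterated concatenations are taken left to right). $T_0(w)=w$; for $p\in\mathbb N$, $T_p(w)$ is the word of the same length obtained by replacing each $w_i=\upsilon$ by $\alpha_p$ if $k_i\ge p$ and by $\alpha_{k_i}$ if $k_i<p$, leaving letters of $\Sigma$ unchanged. $W^\infty(\Sigma,\vec k;\upsilon)$ is the set of sequences $(w_n)_{n\in\mathbb N}$ in $W(\Sigma,\vec k;\upsilon)$ with $w_n<w_{n+1}$ for all $n$. *)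

theory Defs
  imports Main
begin

text \<open>
  Words are lists over a letter type. Positions, the sequence \<open>k\<close>, the enumeration \<open>\<alpha>\<close> of the
  alphabet and all sequences of words are indexed from 1; the value of a sequence at 0 is never used.
  Since lists are indexed from 0, the \<open>i\<close>-th letter of \<open>w\<close> is \<open>w ! (i - 1)\<close>.
\<close>

definition words :: "(nat \<Rightarrow> 'a) \<Rightarrow> (nat \<Rightarrow> nat) \<Rightarrow> 'a list set" where
  "words \<alpha> k = {w. length w \<ge> 1 \<and> (\<forall>i\<in>{1..length w}. w ! (i - 1) \<in> \<alpha> ` {1..k i})}"

definition var_words :: "(nat \<Rightarrow> 'a) \<Rightarrow> 'a \<Rightarrow> (nat \<Rightarrow> nat) \<Rightarrow> 'a list set" where
  "var_words \<alpha> \<upsilon> k = {w. length w \<ge> 1 \<and>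
     (\<forall>i\<in>{1..length w}. w ! (i - 1) \<in> insert \<upsilon> (\<alpha> ` {1..k i})) \<and>
     (\<exists>i\<in>{1..length w}. w ! (i - 1) = \<upsilon>)}"

definition word_less :: "(nat \<Rightarrow> 'a) \<Rightarrow> 'a list \<Rightarrow> 'a list \<Rightarrow> bool" where
  "word_less \<alpha> w u \<longleftrightarrow> length w < length u \<and> (\<forall>i\<in>{1..length w}. u ! (i - 1) = \<alpha> 1)"

text \<open>
  The operation \<open>w \<star> u\<close> is only meaningful if \<open>word_less \<alpha> w u\<close>; it is made total by the same formula.
  In iterated products of substitution instances of the terms of a sequence in \<open>var_word_seqs\<close>
  this condition always holds, because \<open>subst_word\<close> preserves lengths and letters of the alphabet.
\<close>

definition star :: "'a list \<Rightarrow> 'a list \<Rightarrow> 'a list" (infixl "\<star>" 70) where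
  "w \<star> u = w @ drop (length w) u"

text \<open>\<open>star_prod x l\<close> is \<open>(\<dots>((x 1 \<star> x 2) \<star> x 3) \<dots>) \<star> x l\<close>, for \<open>l \<ge> 1\<close>.\<close>

definition star_prod :: "(nat \<Rightarrow> 'a list) \<Rightarrow> nat \<Rightarrow> 'a list" where
  "star_prod x l = foldl (\<star>) (x 1) (map x [2..<Suc l])"

text \<open>\<open>subst_word \<alpha> \<upsilon> k p\<close> is the map \<open>T\<^sub>p\<close>.\<close>

definition subst_word :: "(nat \<Rightarrow> 'a) \<Rightarrow> 'a \<Rightarrow> (nat \<Rightarrow> nat) \<Rightarrow> nat \<Rightarrow> 'a list \<Rightarrow> 'a list" where
  "subst_word \<alpha> \<upsilon> k p w =
     (if p = 0 then w
      else map (\<lambda>i. if w ! (i - 1) = \<upsilon> then (if p \<le> k i then \<alpha> p else \<alpha> (k i)) else w ! (i - 1))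
             [1..<Suc (length w)])"

definition var_word_seqs :: "(nat \<Rightarrow> 'a) \<Rightarrow> 'a \<Rightarrow> (nat \<Rightarrow> nat) \<Rightarrow> (nat \<Rightarrow> 'a list) set" where
  "var_word_seqs \<alpha> \<upsilon> k =
     {w. \<forall>n\<ge>1. w n \<in> var_words \<alpha> \<upsilon> k \<and> word_less \<alpha> (w n) (w (n + 1))}"

end

theory Submission
  imports Defs
begin

text \<open>
  The operation \<open>\<star>\<close> is associative on all lists, and every \<open>T\<^sub>a\<close> is an endomorphism. Extend \<open>\<star>\<close> to
  ultrafilters that contain all the tails \<open>{u. w < u}\<close>. Let \<open>p\<close> be an idempotent in a minimal left
  ideal of the ultrafilters on the constant words, and let \<open>q\<close> be an idempotent on the variable words
  with \<open>p \<star> q = q \<star> p = q\<close>. For \<open>a \<ge> 1\<close> the idempotent \<open>T\<^sub>a q\<close> lies below \<open>T\<^sub>a p = p\<close>, so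
  \<open>T\<^sub>a q = p\<close> by minimality. Choosing the colours that belong to \<open>q\<close> and \<open>p\<close>, the words \<open>u\<^sub>n\<close>
  are then found one after the other, because only finitely many conditions have to be met at
  each step. No topology is needed: closed sets of ultrafilters are represented by filters.
\<close>

section \<open>Ultrafilters\<close>

definition ultra :: "'a filter \<Rightarrow> bool" where
  "ultra F \<longleftrightarrow> F \<noteq> bot \<and> (\<forall>P. eventually P F \<or> eventually (\<lambda>x. \<not> P x) F)"

lemma ultra_not_bot: "ultra F \<Longrightarrow> F \<noteq> bot"
  by (simp add: ultra_def)

lemma ultra_not_eventually:
  assumes "ultra F"
  shows "\<not> eventually P F \<longleftrightarrow> eventually (\<lambda>x. \<not> P x) F"
proof
  assume "eventually (\<lambda>x. \<not> P x) F"
  moreover have "\<not> eventually (\<lambda>_. False) F"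
    using assms by (simp add: ultra_def trivial_limit_def)
  ultimately show "\<not> eventually P F"
    by (auto dest: eventually_conj)
qed (use assms in \<open>auto simp: ultra_def\<close>)

text \<open>If a property of \<open>G\<close> failed for \<open>F\<close>, its negation would hold
  in \<open>F\<close> and hence in \<open>G\<close>, making \<open>G\<close> improper. Later this
  turns inequalities into equations.\<close>

lemma ultra_minimal:
  assumes "ultra F" "G \<le> F" "G \<noteq> bot"
  shows "G = F"
proof (rule antisym[OF assms(2)], rule filter_leI)
  fix P assume "eventually P G"
  show "eventually P F"
  proof (rule ccontr)
    assume "\<not> eventually P F"
    then have "eventually (\<lambda>x. \<not> P x) G"
      using assms(1,2) by (auto simp: ultra_not_eventually le_filter_def)
    with \<open>eventually P G\<close> have "eventually (\<lambda>_. False) G"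
      by eventually_elim auto
    then show False using assms(3) by (simp add: trivial_limit_def)
  qed
qed

lemma ultra_finite_Union:
  assumes "ultra F" "finite I" "eventually (\<lambda>x. x \<in> (\<Union>i\<in>I. B i)) F"
  shows "\<exists>i\<in>I. eventually (\<lambda>x. x \<in> B i) F"
proof (rule ccontr)
  assume "\<not> ?thesis"
  then have "\<forall>i\<in>I. eventually (\<lambda>x. x \<notin> B i) F"
    using ultra_not_eventually[OF assms(1)] by blast
  then have "eventually (\<lambda>x. \<forall>i\<in>I. x \<notin> B i) F"
    using assms(2) by (simp add: eventually_ball_finite)
  with assms(3) have "eventually (\<lambda>_. False) F"
    by eventually_elim auto
  then show False using ultra_not_bot[OF assms(1)] by (simp add: trivial_limit_def)
qed

lemma ultra_filtermap:
  assumes "ultra F"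
  shows "ultra (filtermap f F)"
  using assms by (auto simp: ultra_def eventually_filtermap filtermap_bot_iff)

text \<open>Zorn's lemma downwards; it takes the place of compactness. It yields ultrafilters (with
  trivial \<open>Q\<close>), minimal closed subsemigroups and minimal closed left ideals.\<close>

lemma minimal_filter_exists:
  fixes Q :: "'a filter \<Rightarrow> bool"
  assumes "Q F0" "F0 \<noteq> bot"
    and chain: "\<And>\<C>. \<C> \<noteq> {} \<Longrightarrow> \<forall>F\<in>\<C>. Q F \<Longrightarrow> Q (Inf \<C>)"
  obtains F where "F \<le> F0" "F \<noteq> bot" "Q F"
    "\<And>G. G \<le> F \<Longrightarrow> G \<noteq> bot \<Longrightarrow> Q G \<Longrightarrow> G = F"
proof -
  define S where "S = {F. F \<le> F0 \<and> F \<noteq> bot \<and> Q F}"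
  have po: "partial_order_on S (relation_of (\<ge>) S)"
    by (rule partial_order_on_relation_ofI) auto
  have "\<exists>m\<in>S. \<forall>a\<in>S. a \<le> m \<longrightarrow> a = m"
  proof (rule predicate_Zorn[OF po])
    fix \<C> assume "\<C> \<in> Chains (relation_of (\<ge>) S)"
    then have sub: "\<C> \<subseteq> S" and lin: "\<And>F G. F \<in> \<C> \<Longrightarrow> G \<in> \<C> \<Longrightarrow> F \<le> G \<or> G \<le> F"
      by (auto simp: Chains_def relation_of_def)
    show "\<exists>u\<in>S. \<forall>a\<in>\<C>. u \<le> a"
    proof (cases "\<C> = {}")
      case True
      then show ?thesis using assms(1,2) by (auto simp: S_def)
    next
      case False
      \<comment> \<open>A chain is directed, so whatever holds eventually in its infimum already
        does so in one member. Hence the infimum stays proper.\<close>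
      have ev: "eventually P (Inf \<C>) \<longleftrightarrow> (\<exists>F\<in>\<C>. eventually P F)" for P
        by (rule eventually_Inf_base[OF False]) (use lin in \<open>fastforce simp: inf_absorb1 inf_absorb2\<close>)
      have "Inf \<C> \<noteq> bot"
        unfolding trivial_limit_def ev using sub by (auto simp: S_def trivial_limit_def)
      moreover have "Inf \<C> \<le> F0"
        using False sub by (metis (no_types, lifting) Inf_lower2 S_def all_not_in_conv mem_Collect_eq subsetD)
      moreover have "Q (Inf \<C>)"
        using chain[OF False] sub by (auto simp: S_def)
      ultimately show ?thesis
        by (intro bexI[of _ "Inf \<C>"]) (auto simp: S_def Inf_lower)
    qed
  qed
  then obtain F where "F \<in> S" "\<And>a. a \<in> S \<Longrightarrow> a \<le> F \<Longrightarrow> a = F" by blast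
  then show ?thesis
    by (intro that[of F]) (auto simp: S_def intro: order_trans)
qed

lemma ultra_exists:
  assumes "F0 \<noteq> bot"
  obtains F where "F \<le> F0" "ultra F"
proof -
  obtain F where F: "F \<le> F0" "F \<noteq> bot" "\<And>G. G \<le> F \<Longrightarrow> G \<noteq> bot \<Longrightarrow> G = F"
    using minimal_filter_exists[of "\<lambda>_. True" F0] assms by auto
  have "eventually P F \<or> eventually (\<lambda>x. \<not> P x) F" for P
  \<comment> \<open>Adding the set of \<open>P\<close> to \<open>F\<close> either destroys
    properness or, by minimality, changes nothing.\<close>
  proof (cases "inf F (principal {x. P x}) = bot")
    case True
    then have "eventually (\<lambda>x. \<not> P x) F"
      by (simp add: trivial_limit_def eventually_inf_principal)
    then show ?thesis ..
  next
    case False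
    then have "inf F (principal {x. P x}) = F" by (intro F(3)) auto
    moreover have "eventually P (inf F (principal {x. P x}))"
      by (simp add: eventually_inf_principal)
    ultimately show ?thesis by simp
  qed
  with F show ?thesis by (intro that[of F]) (auto simp: ultra_def)
qed

section \<open>The product of filters on a semigroup\<close>

context semigroup
begin

text \<open>On ultrafilters this is the usual extension of the operation to the Stone-Cech
  compactification. It is defined for all filters so that it also acts on those standing for closed
  sets: if \<open>F \<odot> F \<le> F\<close>, the ultrafilters below \<open>F\<close> form a
  subsemigroup.\<close>

definition filter_mult :: "'a filter \<Rightarrow> 'a filter \<Rightarrow> 'a filter" (infixl "\<odot>" 70) where
  "F \<odot> G = Abs_filter (\<lambda>P. eventually (\<lambda>x. eventually (\<lambda>y. P (x \<^bold>* y)) G) F)"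

lemma eventually_filter_mult:
  "eventually P (F \<odot> G) \<longleftrightarrow> eventually (\<lambda>x. eventually (\<lambda>y. P (x \<^bold>* y)) G) F"
  unfolding filter_mult_def
proof (rule eventually_Abs_filter, unfold_locales, goal_cases)
  case (2 P Q)
  then show ?case by eventually_elim (rule eventually_conj)
next
  case (3 P Q)
  from 3(2) show ?case by (rule eventually_mono) (use 3(1) in \<open>auto elim: eventually_mono\<close>)
qed simp

lemma filter_mult_assoc: "(F \<odot> G) \<odot> H = F \<odot> (G \<odot> H)"
  by (simp add: filter_eq_iff eventually_filter_mult assoc)

lemma filter_mult_mono:
  assumes "F \<le> F'" "G \<le> G'"
  shows "F \<odot> G \<le> F' \<odot> G'"
proof (rule filter_leI)
  fix P assume "eventually P (F' \<odot> G')"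
  then have "eventually (\<lambda>x. eventually (\<lambda>y. P (x \<^bold>* y)) G') F"
    using assms(1) by (simp add: eventually_filter_mult le_filter_def)
  then show "eventually P (F \<odot> G)"
    unfolding eventually_filter_mult
    by (rule eventually_mono) (use assms(2) in \<open>simp add: le_filter_def\<close>)
qed

lemma filter_mult_not_bot:
  assumes "F \<noteq> bot" "G \<noteq> bot"
  shows "F \<odot> G \<noteq> bot"
  using assms by (simp add: trivial_limit_def eventually_filter_mult)

lemma ultra_filter_mult:
  assumes "ultra F" "ultra G"
  shows "ultra (F \<odot> G)"
proof -
  have "eventually P (F \<odot> G) \<or> eventually (\<lambda>x. \<not> P x) (F \<odot> G)" for P
    unfolding eventually_filter_mult ultra_not_eventually[OF assms(2), symmetric]
    using assms(1) by (simp add: ultra_def)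
  then show ?thesis
    using assms by (simp add: ultra_def filter_mult_not_bot)
qed

lemma filtermap_filter_mult:
  assumes "\<And>x y. h (x \<^bold>* y) = h x \<^bold>* h y"
  shows "filtermap h (F \<odot> G) = filtermap h F \<odot> filtermap h G"
  by (simp add: filter_eq_iff eventually_filter_mult eventually_filtermap assms)

text \<open>The map \<open>x \<mapsto> x \<odot> t\<close> sends the closed set of ultrafilters below \<open>M\<close> onto the one below \<open>M \<odot> t\<close>.\<close>

lemma ultra_le_filter_mult:
  assumes "ultra t" "ultra p" "p \<le> M \<odot> t"
  obtains x where "x \<le> M" "x \<noteq> bot" "x \<odot> t = p"
proof -
  \<comment> \<open>\<open>G\<close> is generated by the sets of all \<open>w\<close> such that
    \<open>P\<close> holds at the product of \<open>w\<close> with \<open>t\<close>-almost every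
    \<open>u\<close>, one set for each \<open>P\<close> in \<open>p\<close>. Thus
    \<open>x \<le> G\<close> iff \<open>x \<odot> t \<le> p\<close>.\<close>
  define G where "G = Abs_filter (\<lambda>B. \<exists>P. eventually P p \<and>
    (\<forall>w. eventually (\<lambda>u. P (w \<^bold>* u)) t \<longrightarrow> B w))"
  have G: "eventually B G \<longleftrightarrow> (\<exists>P. eventually P p \<and>
    (\<forall>w. eventually (\<lambda>u. P (w \<^bold>* u)) t \<longrightarrow> B w))" for B
    unfolding G_def
  proof (rule eventually_Abs_filter, unfold_locales, goal_cases)
    case (2 B B')
    then obtain P P' where "eventually P p" "\<forall>w. eventually (\<lambda>u. P (w \<^bold>* u)) t \<longrightarrow> B w"
      "eventually P' p" "\<forall>w. eventually (\<lambda>u. P' (w \<^bold>* u)) t \<longrightarrow> B' w"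
      by blast
    then show ?case
      by (intro exI[of _ "\<lambda>x. P x \<and> P' x"]) (simp add: eventually_conj_iff)
  qed (use eventually_True in blast)+
  have "inf M G \<noteq> bot"
  proof
    assume "inf M G = bot"
    then obtain B B' where B: "eventually B M" "eventually B' G" "\<And>w. \<not> (B w \<and> B' w)"
      by (auto simp: trivial_limit_def eventually_inf)
    then obtain P where P: "eventually P p" "\<And>w. eventually (\<lambda>u. P (w \<^bold>* u)) t \<Longrightarrow> B' w"
      by (auto simp: G)
    \<comment> \<open>Outside \<open>B'\<close>, in particular on \<open>B\<close>, \<open>P\<close>
      fails for the product with \<open>t\<close>-almost every \<open>u\<close>, as \<open>t\<close>
      is an ultrafilter. So the negation of \<open>P\<close> enters \<open>M \<odot> t\<close> and
      then \<open>p\<close>.\<close>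
    have "eventually (\<lambda>w. eventually (\<lambda>u. \<not> P (w \<^bold>* u)) t) M"
      using B(1) by (rule eventually_mono) (use B(3) P(2) ultra_not_eventually[OF assms(1)] in blast)
    then have "eventually (\<lambda>w. \<not> P w) (M \<odot> t)"
      by (simp add: eventually_filter_mult)
    then show False
      using assms(2,3) P(1) ultra_not_eventually[OF assms(2)] by (auto simp: le_filter_def)
  qed
  moreover have "inf M G \<odot> t \<le> p"
  proof (rule filter_leI)
    fix P assume "eventually P p"
    then have "eventually (\<lambda>w. eventually (\<lambda>u. P (w \<^bold>* u)) t) G"
      unfolding G by blast
    then show "eventually P (inf M G \<odot> t)"
      unfolding eventually_filter_mult by (rule filter_leD[OF inf_le2])
  qed
  ultimately show ?thesis
    using that[of "inf M G"] ultra_minimal[OF assms(2)] filter_mult_not_bot ultra_not_bot[OF assms(1)]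
    by auto
qed

section \<open>Idempotent ultrafilters and their order\<close>

lemma filter_mult_Sup_le:
  assumes "\<And>x. x \<in> X \<Longrightarrow> x \<odot> t \<le> p"
  shows "Sup X \<odot> t \<le> p"
  using assms by (auto simp: le_filter_def eventually_filter_mult eventually_Sup)

text \<open>The Ellis-Numakura lemma: a minimal \<open>F\<close> with
  \<open>F \<odot> F \<le> F\<close> turns out to be an ultrafilter.\<close>

lemma idempotent_ultra_exists:
  assumes "F0 \<noteq> bot" "F0 \<odot> F0 \<le> F0"
  obtains p where "p \<le> F0" "ultra p" "p \<odot> p = p"
proof -
  obtain F where F: "F \<le> F0" "F \<noteq> bot" "F \<odot> F \<le> F"
    and Fmin: "\<And>G. G \<le> F \<Longrightarrow> G \<noteq> bot \<Longrightarrow> G \<odot> G \<le> G \<Longrightarrow> G = F"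
  proof (rule minimal_filter_exists[of "\<lambda>F. F \<odot> F \<le> F" F0])
    fix \<C> :: "'a filter set" assume "\<forall>F\<in>\<C>. F \<odot> F \<le> F"
    then show "Inf \<C> \<odot> Inf \<C> \<le> Inf \<C>"
      by (meson Inf_greatest Inf_lower filter_mult_mono order_trans)
  qed (use assms in auto)
  obtain p where p: "p \<le> F" "ultra p"
    using ultra_exists[OF F(2)] .
  \<comment> \<open>\<open>F \<odot> p\<close> is a subsemigroup inside \<open>F\<close>, so
    minimality forces equality.\<close>
  have "F \<odot> p \<le> F"
    using filter_mult_mono[OF order_refl p(1)] F(3) by (rule order_trans)
  moreover have "(F \<odot> p) \<odot> (F \<odot> p) \<le> F \<odot> p"
    unfolding filter_mult_assoc[symmetric]
    using filter_mult_mono[OF filter_mult_mono[OF \<open>F \<odot> p \<le> F\<close> order_refl] order_refl]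
      filter_mult_mono[OF F(3) order_refl] by (rule order_trans)
  ultimately have Fp: "F \<odot> p = F"
    using Fmin filter_mult_not_bot F(2) ultra_not_bot[OF p(2)] by blast
  \<comment> \<open>\<open>X\<close> stands for the closed set of solutions of
    \<open>x \<odot> p = p\<close> in \<open>F\<close>. It is nonempty because \<open>p\<close> lies
    below \<open>F \<odot> p\<close>, and it is a subsemigroup, so it is all of
    \<open>F\<close>.\<close>
  define X where "X = Sup {x. x \<le> F \<and> x \<odot> p \<le> p}"
  obtain x where x: "x \<le> F" "x \<noteq> bot" "x \<odot> p = p"
    using ultra_le_filter_mult[OF p(2,2)] p(1) Fp by metis
  have Xp: "X \<odot> p \<le> p"
    unfolding X_def by (rule filter_mult_Sup_le) auto
  have XF: "X \<le> F"
    unfolding X_def by (rule Sup_least) auto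
  have "x \<le> X"
    unfolding X_def by (rule Sup_upper) (use x in auto)
  then have "X \<noteq> bot"
    using x(2) by (auto simp: bot_unique)
  moreover have "X \<odot> X \<le> X"
  proof -
    have "X \<odot> X \<odot> p \<le> p"
      unfolding filter_mult_assoc
      using filter_mult_mono[OF order_refl Xp] Xp by (rule order_trans)
    moreover have "X \<odot> X \<le> F"
      using filter_mult_mono[OF XF XF] F(3) by (rule order_trans)
    ultimately show ?thesis
      by (subst (3) X_def) (intro Sup_upper, simp)
  qed
  ultimately have "X = F"
    using Fmin XF by blast
  \<comment> \<open>Now \<open>F = F \<odot> p = X \<odot> p \<le> p\<close>.\<close>
  then have "F = p"
    using Xp Fp p(1) by auto
  then show ?thesis
    using that[of p] F(1) p(2) Fp by simp
qed

text \<open>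
  Here idempotents are ordered by: \<open>t\<close> is below \<open>p\<close> iff \<open>t \<odot> p = p \<odot> t = t\<close>.
\<close>

lemma minimal_idempotent_ultra_exists:
  assumes "M \<noteq> bot" "M \<odot> M \<le> M"
  obtains p where "p \<le> M" "ultra p" "p \<odot> p = p"
    "\<And>t. t \<le> M \<Longrightarrow> ultra t \<Longrightarrow> t \<odot> t = t \<Longrightarrow> t \<odot> p = t \<Longrightarrow> p \<odot> t = t \<Longrightarrow> t = p"
proof -
  \<comment> \<open>\<open>F\<close> stands for a minimal closed left ideal.\<close>
  obtain F where F: "F \<le> M" "F \<noteq> bot" "M \<odot> F \<le> F"
    and Fmin: "\<And>G. G \<le> F \<Longrightarrow> G \<noteq> bot \<Longrightarrow> M \<odot> G \<le> G \<Longrightarrow> G = F"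
  proof (rule minimal_filter_exists[of "\<lambda>F. M \<odot> F \<le> F" M])
    fix \<C> :: "'a filter set" assume "\<forall>F\<in>\<C>. M \<odot> F \<le> F"
    then show "M \<odot> Inf \<C> \<le> Inf \<C>"
      by (meson Inf_greatest Inf_lower filter_mult_mono order_refl order_trans)
  qed (use assms in auto)
  have "F \<odot> F \<le> F"
    using filter_mult_mono[OF F(1) order_refl] F(3) by (rule order_trans)
  then obtain p where p: "p \<le> F" "ultra p" "p \<odot> p = p"
    using idempotent_ultra_exists[OF F(2)] by blast
  show ?thesis
  proof (rule that[OF order_trans[OF p(1) F(1)] p(2,3)])
    fix t assume t: "t \<le> M" "ultra t" "t \<odot> t = t" "t \<odot> p = t" "p \<odot> t = t"
    have "t \<le> F"
      using order_trans[OF filter_mult_mono[OF t(1) p(1)] F(3)] t(4) by simp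
    \<comment> \<open>The left ideal \<open>M \<odot> t\<close> lies inside the minimal one, so
      \<open>p\<close> is below it and equals \<open>x \<odot> t\<close> for some \<open>x\<close>.
      As \<open>t\<close> is idempotent, \<open>p \<odot> t = p\<close>.\<close>
    have "M \<odot> t = F"
    proof (rule Fmin)
      show "M \<odot> t \<le> F"
        using filter_mult_mono[OF order_refl \<open>t \<le> F\<close>] F(3) by (rule order_trans)
      show "M \<odot> t \<noteq> bot"
        using assms(1) t(2) by (simp add: filter_mult_not_bot ultra_not_bot)
      show "M \<odot> (M \<odot> t) \<le> M \<odot> t"
        unfolding filter_mult_assoc[symmetric] by (rule filter_mult_mono[OF assms(2) order_refl])
    qed
    then obtain x where "x \<odot> t = p"
      using ultra_le_filter_mult[OF t(2) p(2)] p(1) by metis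
    then have "p \<odot> t = p"
      using filter_mult_assoc t(3) by metis
    then show "t = p"
      using t(5) by simp
  qed
qed

text \<open>\<open>N\<close> absorbs \<open>M\<close> on both sides, like an ideal. An idempotent
  \<open>e\<close> of \<open>N \<odot> p\<close> is fixed by \<open>p\<close> on the right;
  multiplying it by \<open>p\<close> on the left keeps it idempotent and makes it fixed on both
  sides.\<close>

lemma idempotent_ultra_below:
  assumes N: "N \<noteq> bot" "N \<odot> N \<le> N" "M \<odot> N \<le> N" "N \<odot> M \<le> N"
    and p: "p \<le> M" "ultra p" "p \<odot> p = p"
  obtains q where "q \<le> N" "ultra q" "q \<odot> q = q" "p \<odot> q = q" "q \<odot> p = q"
proof -
  have le: "N \<odot> p \<le> N"
    using filter_mult_mono[OF order_refl p(1)] N(4) by (rule order_trans)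
  have "(N \<odot> p) \<odot> (N \<odot> p) \<le> N \<odot> p"
    unfolding filter_mult_assoc[symmetric]
    using filter_mult_mono[OF filter_mult_mono[OF le order_refl] order_refl]
      filter_mult_mono[OF N(2) order_refl] by (rule order_trans)
  then obtain e where e: "e \<le> N \<odot> p" "ultra e" "e \<odot> e = e"
    using idempotent_ultra_exists[of "N \<odot> p"] filter_mult_not_bot[OF N(1) ultra_not_bot[OF p(2)]]
    by blast
  have ep: "e \<odot> p = e"
    using ultra_le_filter_mult[OF p(2) e(2) e(1)] p(3) filter_mult_assoc by metis
  show ?thesis
  proof (rule that[of "p \<odot> e"])
    show "p \<odot> e \<le> N"
      using filter_mult_mono[OF p(1) order_trans[OF e(1) le]] N(3) by (rule order_trans)
    show "ultra (p \<odot> e)"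
      using p(2) e(2) by (rule ultra_filter_mult)
    show "p \<odot> e \<odot> (p \<odot> e) = p \<odot> e" "p \<odot> (p \<odot> e) = p \<odot> e" "p \<odot> e \<odot> p = p \<odot> e"
      using ep e(3) p(3) filter_mult_assoc by metis+
  qed
qed

text \<open>
  For \<open>a = 0\<close> the endomorphism \<open>h a\<close> is thought of as the identity, and the label \<open>b\<close> of \<open>D b w\<close>
  records whether a variable occurs in \<open>w\<close>. The elements of \<open>D\<close> are those of \<open>A\<close> and \<open>C\<close> whose
  right translates by \<open>p\<close> and \<open>q\<close> have the expected colours.
\<close>

lemma idempotent_pair_colouring:
  assumes idem: "p \<odot> p = p" "q \<odot> q = q" "p \<odot> q = q" "q \<odot> p = q"
    and h: "h 0 = id" "\<And>a::nat. a \<ge> 1 \<Longrightarrow> filtermap (h a) q = p"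
    and A: "eventually A q" and C: "eventually C p"
  obtains D where "\<And>w. D True w \<Longrightarrow> A w" "\<And>w. D False w \<Longrightarrow> C w"
    "\<And>a. eventually (\<lambda>u. D (a = 0) (h a u)) q"
    "\<And>b w a. D b w \<Longrightarrow> eventually (\<lambda>u. D (b \<or> a = 0) (w \<^bold>* h a u)) q"
proof -
  define D where "D b w = (if b
    then A w \<and> eventually (\<lambda>u. A (w \<^bold>* u)) q \<and> eventually (\<lambda>u. A (w \<^bold>* u)) p
    else C w \<and> eventually (\<lambda>u. A (w \<^bold>* u)) q \<and> eventually (\<lambda>u. C (w \<^bold>* u)) p)" for b w
  \<comment> \<open>The four identities trade one quantifier over \<open>p\<close> or
    \<open>q\<close> for two. So a word with good translates has generically many extensions whose
    translates are good again.\<close>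
  have pp: "eventually P p \<longleftrightarrow> eventually (\<lambda>x. eventually (\<lambda>y. P (x \<^bold>* y)) p) p" for P
    using eventually_filter_mult[of P p p] idem by simp
  have qq: "eventually P q \<longleftrightarrow> eventually (\<lambda>x. eventually (\<lambda>y. P (x \<^bold>* y)) q) q" for P
    using eventually_filter_mult[of P q q] idem by simp
  have pq: "eventually P q \<longleftrightarrow> eventually (\<lambda>x. eventually (\<lambda>y. P (x \<^bold>* y)) q) p" for P
    using eventually_filter_mult[of P p q] idem by simp
  have qp: "eventually P q \<longleftrightarrow> eventually (\<lambda>x. eventually (\<lambda>y. P (x \<^bold>* y)) p) q" for P
    using eventually_filter_mult[of P q p] idem by simp
  have image: "eventually (\<lambda>u. P (h a u)) q \<longleftrightarrow> eventually P (if a = 0 then q else p)" for P a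
    using h eventually_filtermap[of P "h a" q] by (cases "a = 0") auto
  have D_q: "eventually (D True) q"
    unfolding D_def using A qq[of A] qp[of A] by (simp add: eventually_conj_iff)
  have D_p: "eventually (D False) p"
    unfolding D_def using A C pq[of A] pp[of C] by (simp add: eventually_conj_iff)
  \<comment> \<open>Both labels ask for \<open>A\<close> after a factor from \<open>q\<close>, so
    the product gets the label \<open>True\<close> whatever \<open>b\<close> is.\<close>
  have step_q: "eventually (\<lambda>u. D True (w \<^bold>* u)) q" if "D b w" for b w
  proof -
    have "eventually (\<lambda>u. A (w \<^bold>* u)) q"
      using that by (auto simp: D_def split: if_splits)
    then show ?thesis
      using qq[of "\<lambda>u. A (w \<^bold>* u)"] qp[of "\<lambda>u. A (w \<^bold>* u)"]
      by (simp add: D_def eventually_conj_iff assoc)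
  qed
  have step_p: "eventually (\<lambda>u. D b (w \<^bold>* u)) p" if "D b w" for b w
    using that pp[of "\<lambda>u. A (w \<^bold>* u)"] pp[of "\<lambda>u. C (w \<^bold>* u)"] pq[of "\<lambda>u. A (w \<^bold>* u)"]
    by (cases b) (simp_all add: D_def eventually_conj_iff assoc)
  show ?thesis
  proof (rule that[of D])
    show "eventually (\<lambda>u. D (a = 0) (h a u)) q" for a
      using D_q D_p image[of "D (a = 0)" a] by (cases "a = 0") auto
    show "eventually (\<lambda>u. D (b \<or> a = 0) (w \<^bold>* h a u)) q" if "D b w" for b w a
      using step_q[OF that] step_p[OF that] image[of "\<lambda>u. D (b \<or> a = 0) (w \<^bold>* u)" a]
      by (cases "a = 0") auto
  qed (auto simp: D_def)
qed

end

section \<open>The semigroup of words\<close>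

interpretation star: semigroup "(\<star>)"
proof
  fix u v w :: "'a list"
  \<comment> \<open>This maximum is the length of \<open>u \<star> v\<close>; both bracketings drop
    that many letters of \<open>w\<close>.\<close>
  have "length u - length v + length v = max (length u) (length v)" by simp
  then show "u \<star> v \<star> w = u \<star> (v \<star> w)"
    by (simp add: star_def drop_append add.commute) (simp add: max_def)
qed

lemma length_star [simp]: "length (w \<star> u) = max (length w) (length u)"
  by (simp add: star_def)

lemma nth_star: "i < length (w \<star> u) \<Longrightarrow> (w \<star> u) ! i = (if i < length w then w ! i else u ! i)"
  by (auto simp: star_def nth_append)

lemma length_subst_word [simp]: "length (subst_word \<alpha> \<upsilon> k a w) = length w"
  by (simp add: subst_word_def del: upt_Suc)

lemma nth_subst_word:
  "i < length w \<Longrightarrow> subst_word \<alpha> \<upsilon> k a w ! i =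
    (if a \<noteq> 0 \<and> w ! i = \<upsilon> then \<alpha> (min a (k (Suc i))) else w ! i)"
  by (auto simp: subst_word_def min_def simp del: upt_Suc)

lemma subst_word_0: "subst_word \<alpha> \<upsilon> k 0 = id"
  by (auto simp: subst_word_def)

text \<open>Substitution acts on each position by a rule that depends only on the position, and
  products leave letters in their positions.\<close>

lemma subst_word_star:
  "subst_word \<alpha> \<upsilon> k a (w \<star> u) = subst_word \<alpha> \<upsilon> k a w \<star> subst_word \<alpha> \<upsilon> k a u"
  by (rule nth_equalityI) (auto simp: nth_subst_word nth_star)

text \<open>Passes from positions counted from 1 to list indices. \<open>P\<close> receives both, as
  letters are read at the index and \<open>k\<close> at the position.\<close>

lemma ball_positions: "(\<forall>i\<in>{1..n}. P (i - 1) i) \<longleftrightarrow> (\<forall>i<n. P i (Suc i))" for n :: nat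
proof -
  have *: "{1..n} = Suc ` {..<n}"
    using image_Suc_lessThan by simp
  show ?thesis
    unfolding * by auto
qed

lemma words_iff:
  "w \<in> words \<alpha> k \<longleftrightarrow> w \<noteq> [] \<and> (\<forall>i<length w. w ! i \<in> \<alpha> ` {1..k (Suc i)})"
  unfolding words_def mem_Collect_eq ball_positions[of "length w" "\<lambda>j i. w ! j \<in> \<alpha> ` {1..k i}"]
  by (cases w) simp_all

lemma var_words_iff:
  "w \<in> var_words \<alpha> \<upsilon> k \<longleftrightarrow>
    (\<forall>i<length w. w ! i \<in> insert \<upsilon> (\<alpha> ` {1..k (Suc i)})) \<and> (\<exists>i<length w. w ! i = \<upsilon>)"
proof -
  have "(\<exists>i\<in>{1..length w}. w ! (i - 1) = \<upsilon>) \<longleftrightarrow> (\<exists>i<length w. w ! i = \<upsilon>)"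
    using ball_positions[of "length w" "\<lambda>j i. w ! j \<noteq> \<upsilon>"] by blast
  moreover have "1 \<le> length w" if "\<exists>i<length w. w ! i = \<upsilon>"
    using that by linarith
  ultimately show ?thesis
    unfolding var_words_def mem_Collect_eq
      ball_positions[of "length w" "\<lambda>j i. w ! j \<in> insert \<upsilon> (\<alpha> ` {1..k i})"]
    by blast
qed

section \<open>Tail filters of sets of words\<close>

text \<open>The words \<open>u\<close> with \<open>w < u\<close>, where only the length \<open>n\<close> of \<open>w\<close> matters.\<close>

definition starts_with_ones :: "(nat \<Rightarrow> 'a) \<Rightarrow> nat \<Rightarrow> 'a list set" where
  "starts_with_ones \<alpha> n = {u. n < length u \<and> (\<forall>i<n. u ! i = \<alpha> 1)}"

lemma word_less_iff: "word_less \<alpha> w u \<longleftrightarrow> u \<in> starts_with_ones \<alpha> (length w)"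
  unfolding word_less_def starts_with_ones_def
  using ball_positions[of "length w" "\<lambda>j i. u ! j = \<alpha> 1"] by simp

text \<open>The ultrafilters below this filter are those that contain \<open>X\<close> and all the
  tails.\<close>

definition tail_filter :: "(nat \<Rightarrow> 'a) \<Rightarrow> 'a list set \<Rightarrow> 'a list filter" where
  "tail_filter \<alpha> X = (INF n. principal (X \<inter> starts_with_ones \<alpha> n))"

lemma eventually_tail_filter:
  "eventually P (tail_filter \<alpha> X) \<longleftrightarrow> (\<exists>n. \<forall>w\<in>X \<inter> starts_with_ones \<alpha> n. P w)"
proof -
  have "\<exists>x\<in>UNIV. principal (X \<inter> starts_with_ones \<alpha> x)
      \<le> inf (principal (X \<inter> starts_with_ones \<alpha> a)) (principal (X \<inter> starts_with_ones \<alpha> b))" for a b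
    by (intro bexI[of _ "max a b"]) (auto simp: starts_with_ones_def)
  then show ?thesis
    unfolding tail_filter_def
    by (subst eventually_INF_base) (auto simp: eventually_principal)
qed

text \<open>The inner tail may depend on the outer word: once \<open>w\<close> is fixed,
  \<open>u\<close> may be assumed to satisfy \<open>w < u\<close>. The product then inherits the
  leading letters \<open>\<alpha> 1\<close> of \<open>w\<close>.\<close>

lemma tail_filter_mult_le:
  assumes "\<And>w u. w \<in> X \<Longrightarrow> u \<in> Y \<Longrightarrow> word_less \<alpha> w u \<Longrightarrow> w \<star> u \<in> Z"
  shows "star.filter_mult (tail_filter \<alpha> X) (tail_filter \<alpha> Y) \<le> tail_filter \<alpha> Z"
proof (rule filter_leI)
  fix P assume "eventually P (tail_filter \<alpha> Z)"
  then obtain n where n: "\<And>w. w \<in> Z \<Longrightarrow> w \<in> starts_with_ones \<alpha> n \<Longrightarrow> P w"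
    by (auto simp: eventually_tail_filter)
  have "P (w \<star> u)" if "w \<in> X" "w \<in> starts_with_ones \<alpha> n" "u \<in> Y" "u \<in> starts_with_ones \<alpha> (length w)" for w u
    using that by (intro n assms) (auto simp: word_less_iff starts_with_ones_def nth_star)
  then show "eventually P (star.filter_mult (tail_filter \<alpha> X) (tail_filter \<alpha> Y))"
    unfolding star.eventually_filter_mult eventually_tail_filter by blast
qed

lemma letters_star:
  assumes "\<forall>i<length w. P i (w ! i)" "\<forall>i<length u. P i (u ! i)"
  shows "\<forall>i<length (w \<star> u). P i ((w \<star> u) ! i)"
  using assms by (auto simp: nth_star)

lemma words_star:
  assumes "w \<in> words \<alpha> k" "u \<in> words \<alpha> k"
  shows "w \<star> u \<in> words \<alpha> k"
  using assms letters_star[of w "\<lambda>i x. x \<in> \<alpha> ` {1..k (Suc i)}" u]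
  by (simp add: words_iff star_def)

lemma var_words_star_left:
  assumes "w \<in> var_words \<alpha> \<upsilon> k" "u \<in> words \<alpha> k \<union> var_words \<alpha> \<upsilon> k"
  shows "w \<star> u \<in> var_words \<alpha> \<upsilon> k"
proof -
  obtain i where "i < length w" "w ! i = \<upsilon>"
    using assms(1) by (auto simp: var_words_iff)
  then have "\<exists>i<length (w \<star> u). (w \<star> u) ! i = \<upsilon>"
    by (intro exI[of _ i]) (simp add: nth_star)
  then show ?thesis
    using assms letters_star[of w "\<lambda>i x. x \<in> insert \<upsilon> (\<alpha> ` {1..k (Suc i)})" u]
    unfolding var_words_iff words_iff Un_iff by blast
qed

text \<open>The first \<open>length w\<close> letters of \<open>u\<close> are
  \<open>\<alpha> 1\<close>, so each variable of \<open>u\<close> lies beyond \<open>w\<close> and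
  survives.\<close>

lemma var_words_star_right:
  assumes "\<alpha> 1 \<noteq> \<upsilon>" "w \<in> words \<alpha> k" "u \<in> var_words \<alpha> \<upsilon> k" "word_less \<alpha> w u"
  shows "w \<star> u \<in> var_words \<alpha> \<upsilon> k"
proof -
  obtain i where i: "i < length u" "u ! i = \<upsilon>"
    using assms(3) by (auto simp: var_words_iff)
  moreover have "\<not> i < length w"
    using i assms(1,4) by (auto simp: word_less_iff starts_with_ones_def)
  ultimately have "\<exists>i<length (w \<star> u). (w \<star> u) ! i = \<upsilon>"
    by (intro exI[of _ i]) (simp add: nth_star)
  then show ?thesis
    using assms(2,3) letters_star[of w "\<lambda>i x. x \<in> insert \<upsilon> (\<alpha> ` {1..k (Suc i)})" u]
    unfolding var_words_iff words_iff by blast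
qed

lemma subst_word_words:
  assumes "\<upsilon> \<notin> \<alpha> ` {1..}" "w \<in> words \<alpha> k"
  shows "subst_word \<alpha> \<upsilon> k a w = w"
proof (rule nth_equalityI)
  fix i assume "i < length (subst_word \<alpha> \<upsilon> k a w)"
  moreover from this have "w ! i \<noteq> \<upsilon>"
    using assms by (fastforce simp: words_iff)
  ultimately show "subst_word \<alpha> \<upsilon> k a w ! i = w ! i"
    by (simp add: nth_subst_word)
qed simp

lemma subst_word_var_words:
  assumes "\<forall>n\<ge>1. k n \<ge> 1" "a \<ge> 1" "w \<in> var_words \<alpha> \<upsilon> k"
  shows "subst_word \<alpha> \<upsilon> k a w \<in> words \<alpha> k"
proof -
  have "subst_word \<alpha> \<upsilon> k a w ! i \<in> \<alpha> ` {1..k (Suc i)}" if "i < length w" for i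
    using assms that by (auto simp: nth_subst_word var_words_iff)
  moreover have "w \<noteq> []"
    using assms(3) by (auto simp: var_words_iff)
  moreover from this have "subst_word \<alpha> \<upsilon> k a w \<noteq> []"
    by (metis length_0_conv length_subst_word)
  ultimately show ?thesis
    by (simp add: words_iff)
qed

text \<open>The leading letters \<open>\<alpha> 1\<close> are not variables, so substitution keeps a
  word in its tail.\<close>

lemma filtermap_subst_word_le:
  assumes "\<forall>n\<ge>1. k n \<ge> 1" "a \<ge> 1" "\<alpha> 1 \<noteq> \<upsilon>"
  shows "filtermap (subst_word \<alpha> \<upsilon> k a) (tail_filter \<alpha> (var_words \<alpha> \<upsilon> k)) \<le> tail_filter \<alpha> (words \<alpha> k)"
proof (rule filter_leI)
  fix P assume "eventually P (tail_filter \<alpha> (words \<alpha> k))"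
  then obtain n where n: "\<And>w. w \<in> words \<alpha> k \<Longrightarrow> w \<in> starts_with_ones \<alpha> n \<Longrightarrow> P w"
    by (auto simp: eventually_tail_filter)
  have "P (subst_word \<alpha> \<upsilon> k a w)" if "w \<in> var_words \<alpha> \<upsilon> k" "w \<in> starts_with_ones \<alpha> n" for w
    using that assms
    by (intro n subst_word_var_words) (auto simp: starts_with_ones_def nth_subst_word)
  then show "eventually P (filtermap (subst_word \<alpha> \<upsilon> k a) (tail_filter \<alpha> (var_words \<alpha> \<upsilon> k)))"
    unfolding eventually_filtermap eventually_tail_filter by blast
qed

lemma tail_filter_var_words_not_bot:
  assumes "\<forall>n\<ge>1. k n \<ge> 1"
  shows "tail_filter \<alpha> (var_words \<alpha> \<upsilon> k) \<noteq> bot"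
proof -
  have "replicate n (\<alpha> 1) @ [\<upsilon>] \<in> var_words \<alpha> \<upsilon> k \<inter> starts_with_ones \<alpha> n" for n
    using assms by (auto simp: var_words_iff starts_with_ones_def nth_append)
  then show ?thesis
    unfolding trivial_limit_def eventually_tail_filter by blast
qed

section \<open>Recursive choice of the words\<close>

lemma star_prod_1: "star_prod x (Suc 0) = x (Suc 0)"
  by (simp add: star_prod_def)

lemma star_prod_Suc: "l \<ge> 1 \<Longrightarrow> star_prod x (Suc l) = star_prod x l \<star> x (Suc l)"
  by (simp add: star_prod_def)

text \<open>A state of the recursion is the last word with a finite set of labelled words satisfying
  \<open>D\<close>, which contains all products formed so far. The bound on the exponents keeps it
  finite, so the next word has to meet only finitely many conditions, each of which holds eventually
  in \<open>q\<close>.\<close>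

lemma monochromatic_sequence:
  fixes D :: "bool \<Rightarrow> 'a list \<Rightarrow> bool" and h :: "nat \<Rightarrow> 'a list \<Rightarrow> 'a list"
  assumes q: "q \<le> tail_filter \<alpha> (var_words \<alpha> \<upsilon> k)" "q \<noteq> bot"
    and D: "\<And>a. eventually (\<lambda>u. D (a = 0) (h a u)) q"
      "\<And>b w a. D b w \<Longrightarrow> eventually (\<lambda>u. D (b \<or> a = 0) (w \<star> h a u)) q"
  obtains u where "u \<in> var_word_seqs \<alpha> \<upsilon> k"
    "\<And>l n p. l \<ge> 1 \<Longrightarrow> strict_mono_on {1..l} n \<Longrightarrow> \<forall>i\<in>{1..l}. n i \<ge> 1 \<Longrightarrow>
      \<forall>i\<in>{1..l}. p i \<le> k (n i) \<Longrightarrow> D (0 \<in> p ` {1..l}) (star_prod (\<lambda>i. h (p i) (u (n i))) l)"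
proof -
  \<comment> \<open>Added are the products ending in the new word \<open>u\<close>: its instances
    alone, and old products followed by them. The label records whether the exponent 0 has
    occurred.\<close>
  define ext where "ext m u X = X \<union> (\<lambda>a. (a = 0, h a u)) ` {..k m}
    \<union> (\<lambda>((b, w), a). (b \<or> a = 0, w \<star> h a u)) ` (X \<times> {..k m})" for m u and X :: "(bool \<times> 'a list) set"
  define good where "good m v X u X' \<longleftrightarrow>
    u \<in> var_words \<alpha> \<upsilon> k \<and> word_less \<alpha> v u \<and> X' = ext (Suc m) u X" for m v u X X'
  have "\<exists>f. \<forall>m. (finite (snd (f m)) \<and> (\<forall>(b, w)\<in>snd (f m). D b w)) \<and>
      good m (fst (f m)) (snd (f m)) (fst (f (Suc m))) (snd (f (Suc m)))"
  proof (rule dependent_nat_choice, goal_cases)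
    case 1
    \<comment> \<open>The state at 0 just has to satisfy the invariant; its word enters no product,
      as indices start from 1.\<close>
    show ?case by (intro exI[of _ "([], {})"]) simp
  next
    case (2 s m)
    obtain v X where s: "s = (v, X)" by fastforce
    with 2 have X: "finite X" "\<And>b w. (b, w) \<in> X \<Longrightarrow> D b w" by auto
    have "eventually (\<lambda>u. u \<in> var_words \<alpha> \<upsilon> k \<and> word_less \<alpha> v u) (tail_filter \<alpha> (var_words \<alpha> \<upsilon> k))"
      unfolding eventually_tail_filter word_less_iff by blast
    then have "eventually (\<lambda>u. u \<in> var_words \<alpha> \<upsilon> k \<and> word_less \<alpha> v u) q"
      using q(1) by (rule filter_leD[rotated])
    moreover have "eventually (\<lambda>u. \<forall>a\<in>{..k (Suc m)}. D (a = 0) (h a u)) q"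
      by (intro eventually_ball_finite ballI D(1)) simp
    moreover have "eventually (\<lambda>u. \<forall>((b, w), a)\<in>X \<times> {..k (Suc m)}. D (b \<or> a = 0) (w \<star> h a u)) q"
      using X by (intro eventually_ball_finite) (auto intro: D(2))
    ultimately have "eventually (\<lambda>u. (u \<in> var_words \<alpha> \<upsilon> k \<and> word_less \<alpha> v u) \<and>
        (\<forall>(b, w)\<in>ext (Suc m) u X. D b w)) q"
      by eventually_elim (use X(2) in \<open>auto simp: ext_def\<close>)
    then obtain u where "u \<in> var_words \<alpha> \<upsilon> k" "word_less \<alpha> v u" "\<forall>(b, w)\<in>ext (Suc m) u X. D b w"
      using q(2) eventually_happens' by blast
    then show ?case
      using X(1) by (intro exI[of _ "(u, ext (Suc m) u X)"]) (auto simp: s good_def ext_def)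
  qed
  then obtain f where f: "\<And>m b w. (b, w) \<in> snd (f m) \<Longrightarrow> D b w"
    "\<And>m. good m (fst (f m)) (snd (f m)) (fst (f (Suc m))) (snd (f (Suc m)))"
    by fast
  define u X where "u = fst \<circ> f" and "X = snd \<circ> f"
  have u: "u (Suc m) \<in> var_words \<alpha> \<upsilon> k" "word_less \<alpha> (u m) (u (Suc m))" for m
    using f(2)[of m] by (simp_all add: good_def u_def)
  have X: "X (Suc m) = ext (Suc m) (u (Suc m)) (X m)" for m
    using f(2)[of m] by (simp add: good_def u_def X_def)
  have X_mono: "X i \<subseteq> X j" if "i \<le> j" for i j
    using that by (rule lift_Suc_mono_le[rotated]) (auto simp: X ext_def)
  have X_base: "(a = 0, h a (u m)) \<in> X m" if "m \<ge> 1" "a \<le> k m" for a m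
    using that X[of "m - 1"] by (auto simp: ext_def)
  have X_step: "(b \<or> a = 0, w \<star> h a (u m)) \<in> X m"
    if i: "i < m" and w: "(b, w) \<in> X i" and a: "a \<le> k m" for a b w i m
  proof -
    \<comment> \<open>Since \<open>X\<close> is increasing, an earlier product is still available
      when \<open>u m\<close> is chosen, even if indices in between are skipped.\<close>
    obtain m' where m': "m = Suc m'" "i \<le> m'"
      using i by (cases m) auto
    then have "(b, w) \<in> X m'"
      using w X_mono by blast
    then show ?thesis
      using a unfolding m'(1) X ext_def
      by (intro UnI2 image_eqI[of _ _ "((b, w), a)"]) simp_all
  qed
  have prod_in_X: "(0 \<in> p ` {1..l}, star_prod (\<lambda>i. h (p i) (u (n i))) l) \<in> X (n l)"
    if "l \<ge> 1" "strict_mono_on {1..l} n" "\<forall>i\<in>{1..l}. n i \<ge> 1" "\<forall>i\<in>{1..l}. p i \<le> k (n i)"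
    for l and n p :: "nat \<Rightarrow> nat"
    using that
  proof (induction l rule: nat_induct_at_least)
    case base
    then show ?case
      using X_base[of "n 1" "p 1"] by (simp add: star_prod_1 eq_commute[of 0])
  next
    case (Suc l)
    have "strict_mono_on {1..l} n"
      using Suc.prems(1) by (rule monotone_on_subset) auto
    then have "(0 \<in> p ` {1..l}, star_prod (\<lambda>i. h (p i) (u (n i))) l) \<in> X (n l)"
      using Suc.prems by (intro Suc.IH) auto
    moreover have "n l < n (Suc l)"
      using Suc.hyps by (intro strict_mono_onD[OF Suc.prems(1)]) auto
    moreover have "0 \<in> p ` {1..Suc l} \<longleftrightarrow> 0 \<in> p ` {1..l} \<or> p (Suc l) = 0"
      by (auto simp: atLeastAtMostSuc_conv)
    ultimately show ?case
      using Suc.prems(3) X_step Suc.hyps by (simp add: star_prod_Suc)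
  qed
  show ?thesis
  proof (rule that[of u])
    have "u n \<in> var_words \<alpha> \<upsilon> k \<and> word_less \<alpha> (u n) (u (n + 1))" if "n \<ge> 1" for n
      using that u(1)[of "n - 1"] u(2)[of n] by simp
    then show "u \<in> var_word_seqs \<alpha> \<upsilon> k"
      by (simp add: var_word_seqs_def)
  qed (use prod_in_X f(1) in \<open>unfold X_def comp_def, blast\<close>)
qed

theorem theorem1p5:
  fixes \<Sigma> :: "'a set" and \<alpha> :: "nat \<Rightarrow> 'a" and \<upsilon> :: 'a and k :: "nat \<Rightarrow> nat"
    and r s :: nat and A C :: "nat \<Rightarrow> 'a list set"
  assumes "bij_betw \<alpha> {1..} \<Sigma>"
    and "\<upsilon> \<notin> \<Sigma>"
    and "\<forall>n\<ge>1. k n \<ge> 1"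
    and "mono_on {1..} k"
    and "r \<ge> 1" and "s \<ge> 1"
    and "var_words \<alpha> \<upsilon> k = (\<Union>i\<in>{1..r}. A i)"
    and "words \<alpha> k = (\<Union>j\<in>{1..s}. C j)"
  shows "\<exists>u\<in>var_word_seqs \<alpha> \<upsilon> k. \<exists>i0\<in>{1..r}. \<exists>j0\<in>{1..s}.
    (\<forall>l\<ge>1. \<forall>n p :: nat \<Rightarrow> nat.
       strict_mono_on {1..l} n \<and> (\<forall>i\<in>{1..l}. n i \<ge> 1) \<and>
       (\<forall>i\<in>{1..l}. 0 \<le> p i \<and> p i \<le> k (n i)) \<and> 0 \<in> p ` {1..l} \<longrightarrow>
       star_prod (\<lambda>i. subst_word \<alpha> \<upsilon> k (p i) (u (n i))) l \<in> A i0) \<and>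
    (\<forall>l\<ge>1. \<forall>n p :: nat \<Rightarrow> nat.
       strict_mono_on {1..l} n \<and> (\<forall>i\<in>{1..l}. n i \<ge> 1) \<and>
       (\<forall>i\<in>{1..l}. 1 \<le> p i \<and> p i \<le> k (n i)) \<longrightarrow>
       star_prod (\<lambda>i. subst_word \<alpha> \<upsilon> k (p i) (u (n i))) l \<in> C j0)"
proof -
  have \<upsilon>: "\<upsilon> \<notin> \<alpha> ` {1..}"
    using assms(1,2) by (auto simp: bij_betw_def)
  then have \<upsilon>1: "\<alpha> 1 \<noteq> \<upsilon>"
    by auto
  let ?T = "subst_word \<alpha> \<upsilon> k"
  define M N where "M = tail_filter \<alpha> (words \<alpha> k)" and "N = tail_filter \<alpha> (var_words \<alpha> \<upsilon> k)"
  have N: "N \<noteq> bot"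
    unfolding N_def using assms(3) by (rule tail_filter_var_words_not_bot)
  have TN: "filtermap (?T a) N \<le> M" if "a \<ge> 1" for a
    unfolding M_def N_def using assms(3) that \<upsilon>1 by (rule filtermap_subst_word_le)
  \<comment> \<open>The image of the proper filter \<open>N\<close> under \<open>?T 1\<close> is
    proper and lies below \<open>M\<close>.\<close>
  have M: "M \<noteq> bot"
    using TN[of 1] N by (auto simp: bot_unique filtermap_bot_iff)
  have mult: "star.filter_mult M M \<le> M" "star.filter_mult N N \<le> N"
      "star.filter_mult M N \<le> N" "star.filter_mult N M \<le> N"
    unfolding M_def N_def
    by (rule tail_filter_mult_le;
        auto intro: words_star var_words_star_left var_words_star_right[where \<alpha> = \<alpha>, OF \<upsilon>1])+
  obtain p where p: "p \<le> M" "ultra p" "star.filter_mult p p = p"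
    and p_min: "\<And>t. t \<le> M \<Longrightarrow> ultra t \<Longrightarrow> star.filter_mult t t = t \<Longrightarrow> star.filter_mult t p = t
      \<Longrightarrow> star.filter_mult p t = t \<Longrightarrow> t = p"
    using star.minimal_idempotent_ultra_exists[OF M mult(1)] by blast
  obtain q where q: "q \<le> N" "ultra q" "star.filter_mult q q = q"
    "star.filter_mult p q = q" "star.filter_mult q p = q"
    using star.idempotent_ultra_below[OF N mult(2-4) p] .
  have p_words: "eventually (\<lambda>w. w \<in> words \<alpha> k) p"
    using p(1) by (rule filter_leD) (unfold M_def eventually_tail_filter, blast)
  \<comment> \<open>\<open>?T a\<close> is the identity on constant words, that is, on
    \<open>p\<close>-almost all words.\<close>
  have Tp: "filtermap (?T a) p = p" for a
  proof -
    have "eventually (\<lambda>w. ?T a w = w) p"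
      using p_words by (rule eventually_mono) (rule subst_word_words[OF \<upsilon>])
    then have "eventually (\<lambda>w. P (?T a w)) p \<longleftrightarrow> eventually P p" for P
      by (intro eventually_subst) (erule eventually_mono, simp)
    then show ?thesis
      by (simp add: filter_eq_iff eventually_filtermap)
  qed
  \<comment> \<open>As a homomorphism fixing \<open>p\<close>, \<open>?T a\<close> carries the
    identities between \<open>q\<close> and \<open>p\<close> over to the image of \<open>q\<close>,
    which is therefore an idempotent below the minimal \<open>p\<close>.\<close>
  have Tq: "filtermap (?T a) q = p" if "a \<ge> 1" for a
  proof (rule p_min)
    show "filtermap (?T a) q \<le> M"
      using filtermap_mono[OF q(1)] TN[OF that] by (rule order_trans)
    show "ultra (filtermap (?T a) q)"
      using q(2) by (rule ultra_filtermap)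
    note hom = star.filtermap_filter_mult[of "?T a", OF subst_word_star]
    show "star.filter_mult (filtermap (?T a) q) (filtermap (?T a) q) = filtermap (?T a) q"
      "star.filter_mult (filtermap (?T a) q) p = filtermap (?T a) q"
      "star.filter_mult p (filtermap (?T a) q) = filtermap (?T a) q"
      using hom[of q q] hom[of q p] hom[of p q] q(3-5) Tp by simp_all
  qed
  have "eventually (\<lambda>w. w \<in> var_words \<alpha> \<upsilon> k) q"
    using q(1) by (rule filter_leD) (unfold N_def eventually_tail_filter, blast)
  then obtain i0 where i0: "i0 \<in> {1..r}" "eventually (\<lambda>w. w \<in> A i0) q"
    using ultra_finite_Union[OF q(2), of "{1..r}" A] assms(7) by auto
  obtain j0 where j0: "j0 \<in> {1..s}" "eventually (\<lambda>w. w \<in> C j0) p"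
    using ultra_finite_Union[OF p(2), of "{1..s}" C] p_words assms(8) by auto
  obtain D where D: "\<And>w. D True w \<Longrightarrow> w \<in> A i0" "\<And>w. D False w \<Longrightarrow> w \<in> C j0"
    "\<And>a. eventually (\<lambda>u. D (a = 0) (?T a u)) q"
    "\<And>b w a. D b w \<Longrightarrow> eventually (\<lambda>u. D (b \<or> a = 0) (w \<star> ?T a u)) q"
    using star.idempotent_pair_colouring[where h = ?T, OF p(3) q(3-5) subst_word_0 Tq i0(2) j0(2)]
    by blast
  obtain u where u: "u \<in> var_word_seqs \<alpha> \<upsilon> k"
    and prod: "\<And>l n p. l \<ge> 1 \<Longrightarrow> strict_mono_on {1..l} n \<Longrightarrow> \<forall>i\<in>{1..l}. n i \<ge> 1 \<Longrightarrow>
      \<forall>i\<in>{1..l}. p i \<le> k (n i) \<Longrightarrow> D (0 \<in> p ` {1..l}) (star_prod (\<lambda>i. ?T (p i) (u (n i))) l)"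
    using monochromatic_sequence[where h = ?T, OF q(1)[unfolded N_def] ultra_not_bot[OF q(2)] D(3,4)]
    by blast
  show ?thesis
  proof (intro bexI[OF _ u] bexI[OF _ i0(1)] bexI[OF _ j0(1)] conjI allI impI, goal_cases)
    case (1 l n p)
    then show ?case using prod[of l n p] by (intro D(1)) simp
  next
    case (2 l n p)
    then have "0 \<notin> p ` {1..l}" by force
    then show ?case using 2 prod[of l n p] by (intro D(2)) simp
  qed
qed

end
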